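(* Let $(\Sigma_{A},\sigma)$ be a one-sided topologically exact subshift of finite type over the alphabet $\Sigma=\{1,\dots,l\}$, let $\phi\in C(\Sigma_A;\mathbb{R})$ be Hölder continuous, and let $\mu_\phi$ be a Gibbs measure for the potential $\phi$. For any choice of the bijections $(\theta_x)_{x\in\Sigma_A^*}$ and of linear maps $U_x\in\Omega_x$ ($x\in\Sigma_A^*$), let $e_{x,j}$ be the functions defined in the context. Then the set $$\Big\{e_{x,j} : x\in\Sigma_A^{*},\ j\in\{1,2,\dots,\alpha(x)-1\}\Big\}\ \cup\ \Big\{\mu_\phi([x])^{-1/2}\,\mathbf{1}_{[x]} : x\in\Sigma\Big\}$$ is an orthonormal basis of $L^{2}(\Sigma_A,\mathcal{B},\mu_\phi)$ (complex-valued functions).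
   Context: **Subshift.** Fix $l\in\mathbb{N}$ and an irreducible, aperiodic $l\times l$ matrix $A=[a_{j,k}]$ with entries in $\{0,1\}$. Put $\Sigma=\{1,\dots,l\}$, $\Sigma_A=\{\omega=(\omega_1,\omega_2,\dots)\in\Sigma^{\mathbb{N}} : a_{\omega_k,\omega_{k+1}}=1\ \forall k\in\mathbb{N}\}$, $\Sigma_A^k=\{(x_1,\dots,x_k)\in\Sigma^k : a_{x_i,x_{i+1}}=1 \text{ for } 1\le i<k\}$ for $k\ge 1$ (so $\Sigma_A^1=\Sigma$), and $\Sigma_A^*=\bigcup_{k\ge1}\Sigma_A^k$. For $x\in\Sigma_A^k$ the cylinder set is $[x]=\{\omega\in\Sigma_A : (\omega_1,\dots,\omega_k)=x\}$. $\Sigma_A$ carries the compact topology generated by cylinder sets, metrized by $d(\omega,\upsilon)=2^{-\omega\wedge\upsilon}$, where $\omega\wedge\upsilon$ is the length of the longest common initial word; $\mathcal{B}$ is its Borel $\sigma$-algebra; Hölder continuity is with respect to this metric. The shift is $\sigma(\omega_1,\omega_2,\dots)=(\omega_2,\omega_3,\dots)$. Such a system $(\Sigma_A,\sigma)$ is called a one-sided topologically exact subshift of finite type. For $x\in\Sigma_A^k$ put $\alpha(x)=\sum_{i=1}^{l}a_{x_k,i}$ (the number of admissible one-letter continuations of $x$). **Gibbs measure.** For $\phi\in C(\Sigma_A;\mathbb{R})$, $S_k\phi=\sum_{m=0}^{k-1}\phi\circ\sigma^m$. The topological pressure $P(\phi,\sigma)$ is the real number $\sup\{h_\mu(\sigma)+\int\phi\,d\mu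 : \mu \text{ a } \sigma\text{-invariant Borel probability measure}\}$. A Gibbs measure for a Hölder continuous $\phi$ is a Borel probability measure $\mu_\phi$ on $\Sigma_A$ for which there is $c>1$ with $c^{-1}\le \mu_\phi([(\omega_1,\dots,\omega_k)])\,/\,e^{S_k\phi(\omega)-kP(\phi,\sigma)}\le c$ for all $k\in\mathbb{N}$, $\omega\in\Sigma_A$. **Construction of $e_{x,j}$.** For each $x\in\Sigma_A^k$, $k\ge1$, fix a bijection $\theta_x:\{y\in\Sigma : a_{x_k,y}=1\}\to\{1,\dots,\alpha(x)\}$, and write $x\theta_x^{-1}(j)$ for the word $(x_1,\dots,x_k,\theta_x^{-1}(j))$. On $\mathbb{R}^{\alpha(x)}$ use the weighted inner product $\langle r,s\rangle_x=\sum_{j=1}^{\alpha(x)}\mu_\phi([x\theta_x^{-1}(j)])\,r_js_j$, for which the vectors $f_{x,j}=\mu_\phi([x\theta_x^{-1}(j)])^{-1/2}\delta_j$, $1\le j\le\alpha(x)$, form an orthonormal basis ($\delta_j$ = $j$-th standard unit vector). Let $\Omega_x$ be the set of linear maps $U:\mathbb{R}^{\alpha(x)}\to\mathbb{R}^{\alpha(x)}$ with positive determinant, with $\langle Uv,Uu\rangle_x=\langle v,u\rangle_x$ for all $u,v$, and with $U(f_{x,\alpha(x)})=\mu_\phi([x])^{-1/2}(1,1,\dots,1)$. Fix $U_x\in\Omega_x$ for every $x\in\Sigma_A^*$. For $x\in\Sigma_A^*$ and $j\in\{1,\dots,\alpha(x)-1\}$ define $$e_{x,j}=\sum_{k=1}^{\alpha(x)}\mu_\phi([x\theta_x^{-1}(k)])^{-1/2}\,\langle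 f_{x,k},U_x(f_{x,j})\rangle_x\,\mathbf{1}_{[x\theta_x^{-1}(k)]},$$ where $\mathbf{1}_B$ denotes the characteristic function of $B$. (If $\alpha(x)=1$ there are no functions $e_{x,j}$.) *)

theory Defs
  imports "HOL-Probability.Probability" "Jordan_Normal_Form.Determinant"
begin

section \<open>One-sided subshifts of finite type\<close>

text \<open>
  The alphabet is \<open>{1..l}\<close>, whereas the indices of the matrices and vectors of
  \<open>Jordan_Normal_Form\<close> start at 0; hence the shifts by one in \<open>entry\<close> and below.
  A one-sided sequence \<open>(\<omega>\<^sub>1, \<omega>\<^sub>2, \<dots>)\<close> is the function \<open>\<omega> :: nat \<Rightarrow> nat\<close> whose value
  at \<open>i\<close> is the letter \<open>\<omega>\<^sub>i\<^sub>+\<^sub>1\<close>.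
\<close>

definition alphabet :: "nat mat \<Rightarrow> nat set" where
  "alphabet A = {1..dim_row A}"

definition entry :: "nat mat \<Rightarrow> nat \<Rightarrow> nat \<Rightarrow> nat" where
  "entry A i j = A $$ (i - 1, j - 1)"

definition zero_one_matrix :: "nat mat \<Rightarrow> bool" where
  "zero_one_matrix A \<longleftrightarrow> (\<forall>i\<in>alphabet A. \<forall>j\<in>alphabet A. entry A i j \<in> {0, 1})"

definition irreducible_matrix :: "nat mat \<Rightarrow> bool" where
  "irreducible_matrix A \<longleftrightarrow>
     (\<forall>i\<in>alphabet A. \<forall>j\<in>alphabet A. \<exists>n\<ge>1. entry (A ^\<^sub>m n) i j > 0)"

definition aperiodic_matrix :: "nat mat \<Rightarrow> bool" where
  "aperiodic_matrix A \<longleftrightarrow>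
     (\<forall>i\<in>alphabet A. Gcd {n. n \<ge> 1 \<and> entry (A ^\<^sub>m n) i i > 0} = 1)"

definition shift_space :: "nat mat \<Rightarrow> (nat \<Rightarrow> nat) set" where
  "shift_space A =
     {\<omega>. (\<forall>k. \<omega> k \<in> alphabet A) \<and> (\<forall>k. entry A (\<omega> k) (\<omega> (Suc k)) = 1)}"

definition words :: "nat mat \<Rightarrow> nat list set" where
  "words A = {x. x \<noteq> [] \<and> set x \<subseteq> alphabet A \<and>
                 (\<forall>i. Suc i < length x \<longrightarrow> entry A (x ! i) (x ! Suc i) = 1)}"

definition prefix_word :: "(nat \<Rightarrow> nat) \<Rightarrow> nat \<Rightarrow> nat list" where
  "prefix_word \<omega> k = map \<omega> [0..<k]"

definition cylinder :: "nat mat \<Rightarrow> nat list \<Rightarrow> (nat \<Rightarrow> nat) set" where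
  "cylinder A x = {\<omega> \<in> shift_space A. prefix_word \<omega> (length x) = x}"

definition shift_map :: "(nat \<Rightarrow> nat) \<Rightarrow> (nat \<Rightarrow> nat)" where
  "shift_map \<omega> = (\<lambda>i. \<omega> (Suc i))"

text \<open>For equal sequences the longest common initial word is infinite, so the distance is 0.\<close>

definition shift_dist :: "(nat \<Rightarrow> nat) \<Rightarrow> (nat \<Rightarrow> nat) \<Rightarrow> real" where
  "shift_dist \<omega> \<upsilon> =
     (if \<omega> = \<upsilon> then 0 else 2 powr (- real (GREATEST k. prefix_word \<omega> k = prefix_word \<upsilon> k)))"

definition shift_topology :: "nat mat \<Rightarrow> (nat \<Rightarrow> nat) topology" where
  "shift_topology A = topology_generated_by (cylinder A ` words A)"

definition shift_borel :: "nat mat \<Rightarrow> (nat \<Rightarrow> nat) measure" where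
  "shift_borel A = sigma (shift_space A) {U. openin (shift_topology A) U}"

definition holder_continuous :: "nat mat \<Rightarrow> ((nat \<Rightarrow> nat) \<Rightarrow> real) \<Rightarrow> bool" where
  "holder_continuous A \<phi> \<longleftrightarrow>
     (\<exists>C \<gamma>. C \<ge> 0 \<and> \<gamma> > 0 \<and>
        (\<forall>\<omega>\<in>shift_space A. \<forall>\<upsilon>\<in>shift_space A.
           \<bar>\<phi> \<omega> - \<phi> \<upsilon>\<bar> \<le> C * shift_dist \<omega> \<upsilon> powr \<gamma>))"

text \<open>Number of admissible one-letter continuations of a word.\<close>

definition num_ext :: "nat mat \<Rightarrow> nat list \<Rightarrow> nat" where
  "num_ext A x = (\<Sum>i\<in>alphabet A. entry A (last x) i)"

definition successors :: "nat mat \<Rightarrow> nat list \<Rightarrow> nat set" where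
  "successors A x = {y \<in> alphabet A. entry A (last x) y = 1}"


section \<open>Entropy, pressure and Gibbs measures\<close>

definition invariant_measures :: "nat mat \<Rightarrow> (nat \<Rightarrow> nat) measure set" where
  "invariant_measures A =
     {\<mu>. prob_space \<mu> \<and> sets \<mu> = sets (shift_borel A) \<and> distr \<mu> \<mu> shift_map = \<mu>}"

text \<open>Shannon entropy of a finite partition; the convention \<open>0 log 0 = 0\<close> is built in.\<close>

definition partition_entropy :: "'a measure \<Rightarrow> 'a set set \<Rightarrow> real" where
  "partition_entropy \<mu> P = - (\<Sum>C\<in>P. measure \<mu> C * ln (measure \<mu> C))"

text \<open>The join of the partitions \<open>T\<^sup>-\<^sup>i P\<close> for \<open>i < n\<close>.\<close>

definition refined_partition :: "'a measure \<Rightarrow> ('a \<Rightarrow> 'a) \<Rightarrow> 'a set set \<Rightarrow> nat \<Rightarrow> 'a set set" where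
  "refined_partition \<mu> T P n =
     {(\<Inter>i<n. (T ^^ i) -` c i) \<inter> space \<mu> | c. \<forall>i<n. c i \<in> P} - {{}}"

text \<open>Kolmogorov--Sinai entropy: the supremum over all finite measurable partitions.\<close>

definition ks_entropy :: "'a measure \<Rightarrow> ('a \<Rightarrow> 'a) \<Rightarrow> ereal" where
  "ks_entropy \<mu> T =
     (SUP P\<in>{P. finite P \<and> P \<subseteq> sets \<mu> \<and> partition_on (space \<mu>) P}.
        ereal (lim (\<lambda>n. partition_entropy \<mu> (refined_partition \<mu> T P n) / real n)))"

text \<open>The supremum is finite, since the entropies are bounded by the logarithm of the alphabet size.\<close>

definition pressure :: "nat mat \<Rightarrow> ((nat \<Rightarrow> nat) \<Rightarrow> real) \<Rightarrow> real" where
  "pressure A \<phi> =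
     real_of_ereal
       (SUP \<mu>\<in>invariant_measures A. ks_entropy \<mu> shift_map + ereal (LINT \<omega>|\<mu>. \<phi> \<omega>))"

definition birkhoff_sum :: "((nat \<Rightarrow> nat) \<Rightarrow> real) \<Rightarrow> nat \<Rightarrow> (nat \<Rightarrow> nat) \<Rightarrow> real" where
  "birkhoff_sum \<phi> k \<omega> = (\<Sum>m<k. \<phi> ((shift_map ^^ m) \<omega>))"

definition gibbs_measure ::
    "nat mat \<Rightarrow> ((nat \<Rightarrow> nat) \<Rightarrow> real) \<Rightarrow> (nat \<Rightarrow> nat) measure \<Rightarrow> bool" where
  "gibbs_measure A \<phi> \<mu> \<longleftrightarrow>
     prob_space \<mu> \<and> sets \<mu> = sets (shift_borel A) \<and>
     (\<exists>c>1. \<forall>k\<ge>1. \<forall>\<omega>\<in>shift_space A.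
        let r = measure \<mu> (cylinder A (prefix_word \<omega> k)) /
                exp (birkhoff_sum \<phi> k \<omega> - real k * pressure A \<phi>)
        in inverse c \<le> r \<and> r \<le> c)"


section \<open>The functions \<open>e\<^sub>x\<^sub>,\<^sub>j\<close>\<close>

text \<open>The word \<open>x\<close> extended by the letter \<open>\<theta>\<^sub>x\<^sup>-\<^sup>1(j)\<close>.\<close>

definition ext_word :: "nat mat \<Rightarrow> (nat list \<Rightarrow> nat \<Rightarrow> nat) \<Rightarrow> nat list \<Rightarrow> nat \<Rightarrow> nat list" where
  "ext_word A \<theta> x j = x @ [inv_into (successors A x) (\<theta> x) j]"

definition ext_measure ::
    "nat mat \<Rightarrow> (nat \<Rightarrow> nat) measure \<Rightarrow> (nat list \<Rightarrow> nat \<Rightarrow> nat) \<Rightarrow> nat list \<Rightarrow> nat \<Rightarrow> real" where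
  "ext_measure A \<mu> \<theta> x j = measure \<mu> (cylinder A (ext_word A \<theta> x j))"

definition weighted_inner ::
    "nat mat \<Rightarrow> (nat \<Rightarrow> nat) measure \<Rightarrow> (nat list \<Rightarrow> nat \<Rightarrow> nat) \<Rightarrow> nat list
       \<Rightarrow> real Matrix.vec \<Rightarrow> real Matrix.vec \<Rightarrow> real" where
  "weighted_inner A \<mu> \<theta> x r s =
     (\<Sum>j = 1..num_ext A x. ext_measure A \<mu> \<theta> x j * vec_index r (j - 1) * vec_index s (j - 1))"

definition fvec ::
    "nat mat \<Rightarrow> (nat \<Rightarrow> nat) measure \<Rightarrow> (nat list \<Rightarrow> nat \<Rightarrow> nat) \<Rightarrow> nat list \<Rightarrow> nat
       \<Rightarrow> real Matrix.vec" where
  "fvec A \<mu> \<theta> x j = (ext_measure A \<mu> \<theta> x j powr (-1/2)) \<cdot>\<^sub>v unit_vec (num_ext A x) (j - 1)"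

text \<open>A linear map of \<open>\<real>\<^sup>n\<close>, with \<open>n = \<alpha>(x)\<close> depending on \<open>x\<close>, is given by its matrix in the
  standard basis.\<close>

definition Omega ::
    "nat mat \<Rightarrow> (nat \<Rightarrow> nat) measure \<Rightarrow> (nat list \<Rightarrow> nat \<Rightarrow> nat) \<Rightarrow> nat list
       \<Rightarrow> real mat set" where
  "Omega A \<mu> \<theta> x =
     {U \<in> carrier_mat (num_ext A x) (num_ext A x).
        Determinant.det U > 0 \<and>
        (\<forall>u\<in>carrier_vec (num_ext A x). \<forall>v\<in>carrier_vec (num_ext A x).
           weighted_inner A \<mu> \<theta> x (U *\<^sub>v v) (U *\<^sub>v u) = weighted_inner A \<mu> \<theta> x v u) \<and>
        U *\<^sub>v fvec A \<mu> \<theta> x (num_ext A x) =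
          (measure \<mu> (cylinder A x) powr (-1/2)) \<cdot>\<^sub>v Matrix.vec (num_ext A x) (\<lambda>_. 1)}"

definition efun ::
    "nat mat \<Rightarrow> (nat \<Rightarrow> nat) measure \<Rightarrow> (nat list \<Rightarrow> nat \<Rightarrow> nat) \<Rightarrow> (nat list \<Rightarrow> real mat)
       \<Rightarrow> nat list \<Rightarrow> nat \<Rightarrow> (nat \<Rightarrow> nat) \<Rightarrow> complex" where
  "efun A \<mu> \<theta> U x j = (\<lambda>\<omega>.
     \<Sum>k = 1..num_ext A x.
       complex_of_real (ext_measure A \<mu> \<theta> x k powr (-1/2) *
                        weighted_inner A \<mu> \<theta> x (fvec A \<mu> \<theta> x k) (U x *\<^sub>v fvec A \<mu> \<theta> x j)) *
       indicator (cylinder A (ext_word A \<theta> x k)) \<omega>)"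


section \<open>Orthonormal bases of complex \<open>L\<^sup>2\<close>\<close>

text \<open>
  Elements of \<open>L\<^sup>2\<close> are represented by square integrable functions, not by their classes modulo
  almost everywhere equality. Distinct functions of an orthonormal set in the sense below are at
  \<open>L\<^sup>2\<close>-distance \<open>sqrt 2\<close>, so they represent distinct classes.
\<close>

definition L2_space :: "'a measure \<Rightarrow> ('a \<Rightarrow> complex) set" where
  "L2_space M = {f \<in> borel_measurable M. integrable M (\<lambda>x. (cmod (f x))\<^sup>2)}"

definition L2_inner :: "'a measure \<Rightarrow> ('a \<Rightarrow> complex) \<Rightarrow> ('a \<Rightarrow> complex) \<Rightarrow> complex" where
  "L2_inner M f g = (LINT x|M. f x * cnj (g x))"

definition L2_norm :: "'a measure \<Rightarrow> ('a \<Rightarrow> complex) \<Rightarrow> real" where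
  "L2_norm M f = sqrt (LINT x|M. (cmod (f x))\<^sup>2)"

definition L2_orthonormal :: "'a measure \<Rightarrow> ('a \<Rightarrow> complex) set \<Rightarrow> bool" where
  "L2_orthonormal M B \<longleftrightarrow>
     B \<subseteq> L2_space M \<and> (\<forall>f\<in>B. \<forall>g\<in>B. L2_inner M f g = (if f = g then 1 else 0))"

text \<open>An orthonormal basis is an orthonormal set whose complex linear span is dense.\<close>

definition L2_orthonormal_basis :: "'a measure \<Rightarrow> ('a \<Rightarrow> complex) set \<Rightarrow> bool" where
  "L2_orthonormal_basis M B \<longleftrightarrow>
     L2_orthonormal M B \<and>
     (\<forall>f\<in>L2_space M. \<forall>\<epsilon>>0. \<exists>T c. finite T \<and> T \<subseteq> B \<and>
        L2_norm M (\<lambda>x. f x - (\<Sum>b\<in>T. c b * b x)) < \<epsilon>)"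

end

theory Submission
  imports Defs
begin

text \<open>
  The isometry \<open>U\<^sub>x\<close> turns the orthonormal vectors \<open>f\<^sub>x\<^sub>,\<^sub>j\<close> into coefficient vectors of step functions
  on the cylinders \<open>[xy]\<close>. The last of them is the normalised indicator of \<open>[x]\<close>; hence the others,
  the \<open>e\<^sub>x\<^sub>,\<^sub>j\<close> with \<open>j < \<alpha>(x)\<close>, have mean zero on \<open>[x]\<close>. If a word \<open>y\<close> is longer than \<open>x\<close>, then \<open>e\<^sub>x\<^sub>,\<^sub>i\<close>
  is constant on \<open>[y]\<close>, so it is orthogonal to \<open>e\<^sub>y\<^sub>,\<^sub>j\<close>. Conversely the indicator of \<open>[xy]\<close> is a
  combination of the indicator of \<open>[x]\<close> and the \<open>e\<^sub>x\<^sub>,\<^sub>j\<close>, so all indicators of cylinders lie in the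
  span by induction on the length; since the cylinders are an intersection-stable generator of the
  Borel sets, the span is dense. The Gibbs property enters only through the positivity of
  \<open>\<mu>\<^sub>\<phi>([x])\<close>.
\<close>

section \<open>Approximation in complex \<open>L\<^sup>2\<close>\<close>

definition lin_span :: "('a \<Rightarrow> complex) set \<Rightarrow> ('a \<Rightarrow> complex) set" where
  "lin_span B = {\<lambda>x. \<Sum>b\<in>T. c b * b x | T c. finite T \<and> T \<subseteq> B}"

text \<open>
  The approximating functions are required to be square integrable, because the integral of a
  non-integrable function is 0.
\<close>

definition L2_closure :: "'a measure \<Rightarrow> ('a \<Rightarrow> complex) set \<Rightarrow> ('a \<Rightarrow> complex) set" where
  "L2_closure M V =
     {f \<in> L2_space M. \<forall>\<epsilon>>0. \<exists>g\<in>V \<inter> L2_space M. (LINT x|M. (cmod (f x - g x))\<^sup>2) < \<epsilon>}"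

lemma lin_spanI: "finite T \<Longrightarrow> T \<subseteq> B \<Longrightarrow> (\<lambda>x. \<Sum>b\<in>T. c b * b x) \<in> lin_span B"
  unfolding lin_span_def by blast

lemma lin_span_base: "b \<in> B \<Longrightarrow> b \<in> lin_span B"
  unfolding lin_span_def by (rule CollectI, rule exI[of _ "{b}"], rule exI[of _ "\<lambda>_. 1"]) auto

lemma lin_span_0: "(\<lambda>x. 0) \<in> lin_span B"
  unfolding lin_span_def by (rule CollectI, rule exI[of _ "{}"]) auto

lemma lin_span_scale:
  assumes "f \<in> lin_span B"
  shows "(\<lambda>x. a * f x) \<in> lin_span B"
proof -
  obtain T c where T: "finite T" "T \<subseteq> B" and f: "f = (\<lambda>x. \<Sum>b\<in>T. c b * b x)"
    using assms unfolding lin_span_def by blast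
  have "(\<lambda>x. \<Sum>b\<in>T. (a * c b) * b x) \<in> lin_span B"
    using T by (rule lin_spanI)
  then show ?thesis
    by (simp add: f sum_distrib_left mult.assoc)
qed

lemma lin_span_add:
  assumes "f \<in> lin_span B" and "g \<in> lin_span B"
  shows "(\<lambda>x. f x + g x) \<in> lin_span B"
proof -
  obtain T c where T: "finite T" "T \<subseteq> B" and f: "f = (\<lambda>x. \<Sum>b\<in>T. c b * b x)"
    using assms unfolding lin_span_def by blast
  obtain S d where S: "finite S" "S \<subseteq> B" and g: "g = (\<lambda>x. \<Sum>b\<in>S. d b * b x)"
    using assms unfolding lin_span_def by blast
  \<comment> \<open>\<open>T\<close> and \<open>S\<close> may overlap, so both coefficient families
    are extended by zero to the union before being added.\<close>
  let ?e = "\<lambda>b. (if b \<in> T then c b else 0) + (if b \<in> S then d b else 0)"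
  have "f x + g x = (\<Sum>b\<in>T \<union> S. ?e b * b x)" for x
  proof -
    have "f x = (\<Sum>b\<in>T \<union> S. (if b \<in> T then c b else 0) * b x)"
      unfolding f using T S by (intro sum.mono_neutral_cong_left) auto
    moreover have "g x = (\<Sum>b\<in>T \<union> S. (if b \<in> S then d b else 0) * b x)"
      unfolding g using T S by (intro sum.mono_neutral_cong_left) auto
    ultimately show ?thesis
      by (simp add: sum.distrib distrib_right)
  qed
  then have "(\<lambda>x. f x + g x) = (\<lambda>x. \<Sum>b\<in>T \<union> S. ?e b * b x)" by blast
  moreover have "(\<lambda>x. \<Sum>b\<in>T \<union> S. ?e b * b x) \<in> lin_span B"
    using T S by (intro lin_spanI) auto
  ultimately show ?thesis by simp
qed

lemma lin_span_sum:
  assumes "\<And>i. i \<in> I \<Longrightarrow> f i \<in> lin_span B"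
  shows "(\<lambda>x. \<Sum>i\<in>I. f i x) \<in> lin_span B"
  using assms
  by (induction I rule: infinite_finite_induct) (auto intro: lin_span_0 lin_span_add)

section \<open>Square integrable functions and their squared distance\<close>

text \<open>From \<open>2ab <= a^2 + b^2\<close>. It takes the place of Minkowski's inequality:
  squared distances obey the triangle inequality up to the factor 2, which is enough for closure
  arguments.\<close>

lemma cmod_add_power2_le: "(cmod (a + b))\<^sup>2 \<le> 2 * (cmod a)\<^sup>2 + 2 * (cmod b)\<^sup>2"
proof -
  have "(cmod (a + b))\<^sup>2 \<le> (cmod a + cmod b)\<^sup>2"
    by (intro power_mono norm_triangle_ineq) auto
  also have "\<dots> \<le> 2 * (cmod a)\<^sup>2 + 2 * (cmod b)\<^sup>2"
    using sum_squares_bound[of "cmod a" "cmod b"] by (simp add: power2_sum)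
  finally show ?thesis .
qed

lemma L2_space_scale:
  assumes "f \<in> L2_space M"
  shows "(\<lambda>x. a * f x) \<in> L2_space M"
  using assms unfolding L2_space_def by (auto simp: norm_mult power_mult_distrib)

lemma L2_space_add:
  assumes "f \<in> L2_space M" and "g \<in> L2_space M"
  shows "(\<lambda>x. f x + g x) \<in> L2_space M"
proof -
  have [measurable]: "f \<in> borel_measurable M" "g \<in> borel_measurable M"
    and int: "integrable M (\<lambda>x. (cmod (f x))\<^sup>2)" "integrable M (\<lambda>x. (cmod (g x))\<^sup>2)"
    using assms unfolding L2_space_def by auto
  have "integrable M (\<lambda>x. (cmod (f x + g x))\<^sup>2)"
    by (rule Bochner_Integration.integrable_bound[of _ "\<lambda>x. 2 * (cmod (f x))\<^sup>2 + 2 * (cmod (g x))\<^sup>2"])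
      (use int in \<open>auto intro!: AE_I2 simp: cmod_add_power2_le\<close>)
  then show ?thesis unfolding L2_space_def by simp
qed

lemma L2_space_diff:
  assumes "f \<in> L2_space M" and "g \<in> L2_space M"
  shows "(\<lambda>x. f x - g x) \<in> L2_space M"
  using L2_space_add[OF assms(1) L2_space_scale[OF assms(2), of "-1"]] by simp

lemma L2_space_0: "(\<lambda>x. 0) \<in> L2_space M"
  unfolding L2_space_def by simp

lemma L2_space_sum:
  assumes "\<And>i. i \<in> I \<Longrightarrow> f i \<in> L2_space M"
  shows "(\<lambda>x. \<Sum>i\<in>I. f i x) \<in> L2_space M"
  using assms
  by (induction I rule: infinite_finite_induct) (auto intro: L2_space_0 L2_space_add)

lemma (in finite_measure) L2_space_bounded:
  assumes "f \<in> borel_measurable M" and "\<And>x. cmod (f x) \<le> K"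
  shows "f \<in> L2_space M"
proof -
  have "integrable M (\<lambda>x. (cmod (f x))\<^sup>2)"
    using assms by (intro integrable_const_bound[of _ "K\<^sup>2"]) (auto intro!: AE_I2 power_mono)
  then show ?thesis using assms unfolding L2_space_def by simp
qed

lemma (in finite_measure) L2_space_indicator:
  "S \<in> sets M \<Longrightarrow> (indicator S :: 'a \<Rightarrow> complex) \<in> L2_space M"
  by (rule L2_space_bounded[of _ 1]) (auto simp: indicator_def)

lemma L2_dist_triangle:
  assumes "f \<in> L2_space M" and "g \<in> L2_space M" and "h \<in> L2_space M"
  shows "(LINT x|M. (cmod (f x - h x))\<^sup>2) \<le>
           2 * (LINT x|M. (cmod (f x - g x))\<^sup>2) + 2 * (LINT x|M. (cmod (g x - h x))\<^sup>2)"
proof -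
  have int: "integrable M (\<lambda>x. (cmod (f x - h x))\<^sup>2)" "integrable M (\<lambda>x. (cmod (f x - g x))\<^sup>2)"
    "integrable M (\<lambda>x. (cmod (g x - h x))\<^sup>2)"
    using L2_space_diff[OF assms(1,2)] L2_space_diff[OF assms(2,3)] L2_space_diff[OF assms(1,3)]
    unfolding L2_space_def by auto
  have "(LINT x|M. (cmod (f x - h x))\<^sup>2) \<le>
        (LINT x|M. 2 * (cmod (f x - g x))\<^sup>2 + 2 * (cmod (g x - h x))\<^sup>2)"
  proof (rule integral_mono)
    show "(cmod (f x - h x))\<^sup>2 \<le> 2 * (cmod (f x - g x))\<^sup>2 + 2 * (cmod (g x - h x))\<^sup>2" for x
      using cmod_add_power2_le[of "f x - g x" "g x - h x"] by simp
  qed (use int in auto)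
  then show ?thesis using int by simp
qed

section \<open>Closure of a span under linear combinations and limits\<close>

lemma L2_closure_subset: "f \<in> V \<Longrightarrow> f \<in> L2_space M \<Longrightarrow> f \<in> L2_closure M V"
  unfolding L2_closure_def by (intro CollectI conjI allI impI bexI[of _ f]) auto

lemma L2_closure_add:
  assumes f: "f \<in> L2_closure M (lin_span B)" and g: "g \<in> L2_closure M (lin_span B)"
  shows "(\<lambda>x. f x + g x) \<in> L2_closure M (lin_span B)"
  unfolding L2_closure_def
proof (intro CollectI conjI allI impI)
  have fL: "f \<in> L2_space M" and gL: "g \<in> L2_space M"
    using f g unfolding L2_closure_def by auto
  then show "(\<lambda>x. f x + g x) \<in> L2_space M" by (rule L2_space_add)
  fix \<epsilon> :: real assume "\<epsilon> > 0"
  \<comment> \<open>Two errors below \<open>\<epsilon> / 4\<close>, each doubled by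
    \<open>L2_dist_triangle\<close>, stay below \<open>\<epsilon>\<close>.\<close>
  then have "\<epsilon> / 4 > 0" by simp
  obtain f' where f': "f' \<in> lin_span B \<inter> L2_space M" "(LINT x|M. (cmod (f x - f' x))\<^sup>2) < \<epsilon> / 4"
    using f \<open>\<epsilon> / 4 > 0\<close> unfolding L2_closure_def by blast
  obtain g' where g': "g' \<in> lin_span B \<inter> L2_space M" "(LINT x|M. (cmod (g x - g' x))\<^sup>2) < \<epsilon> / 4"
    using g \<open>\<epsilon> / 4 > 0\<close> unfolding L2_closure_def by blast
  have "(LINT x|M. (cmod ((f x + g x) - (f' x + g' x)))\<^sup>2) \<le>
      2 * (LINT x|M. (cmod ((f x + g x) - (f' x + g x)))\<^sup>2) +
      2 * (LINT x|M. (cmod ((f' x + g x) - (f' x + g' x)))\<^sup>2)"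
    using f' g' fL gL by (intro L2_dist_triangle L2_space_add) auto
  also have "\<dots> < \<epsilon>" using f' g' by simp
  finally show "\<exists>h\<in>lin_span B \<inter> L2_space M. (LINT x|M. (cmod (f x + g x - h x))\<^sup>2) < \<epsilon>"
    using f' g' by (intro bexI[of _ "\<lambda>x. f' x + g' x"]) (auto intro: lin_span_add L2_space_add)
qed

lemma L2_closure_scale:
  assumes f: "f \<in> L2_closure M (lin_span B)"
  shows "(\<lambda>x. a * f x) \<in> L2_closure M (lin_span B)"
  unfolding L2_closure_def
proof (intro CollectI conjI allI impI)
  have fL: "f \<in> L2_space M" using f unfolding L2_closure_def by auto
  then show "(\<lambda>x. a * f x) \<in> L2_space M" by (rule L2_space_scale)
  fix \<epsilon> :: real assume "\<epsilon> > 0"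
  \<comment> \<open>The summand 1 keeps the divisor positive when \<open>a = 0\<close>.\<close>
  let ?K = "(cmod a)\<^sup>2 + 1"
  have K: "?K > 0" by (simp add: add_nonneg_pos)
  then have "\<epsilon> / ?K > 0" using \<open>\<epsilon> > 0\<close> by simp
  then obtain f' where f': "f' \<in> lin_span B \<inter> L2_space M" "(LINT x|M. (cmod (f x - f' x))\<^sup>2) < \<epsilon> / ?K"
    using f unfolding L2_closure_def by blast
  have "(cmod (a * f x - a * f' x))\<^sup>2 = (cmod a)\<^sup>2 * (cmod (f x - f' x))\<^sup>2" for x
    by (simp add: norm_mult power_mult_distrib flip: right_diff_distrib)
  then have "(LINT x|M. (cmod (a * f x - a * f' x))\<^sup>2) = (cmod a)\<^sup>2 * (LINT x|M. (cmod (f x - f' x))\<^sup>2)"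
    by simp
  also have "\<dots> \<le> ?K * (LINT x|M. (cmod (f x - f' x))\<^sup>2)"
    by (intro mult_right_mono integral_nonneg_AE) auto
  also have "\<dots> < \<epsilon>" using f'(2) K by (simp add: pos_less_divide_eq mult.commute)
  finally show "\<exists>h\<in>lin_span B \<inter> L2_space M. (LINT x|M. (cmod (a * f x - h x))\<^sup>2) < \<epsilon>"
    using f' by (intro bexI[of _ "\<lambda>x. a * f' x"]) (auto intro: lin_span_scale L2_space_scale)
qed

lemma L2_closure_sum:
  assumes "\<And>i. i \<in> I \<Longrightarrow> f i \<in> L2_closure M (lin_span B)"
  shows "(\<lambda>x. \<Sum>i\<in>I. f i x) \<in> L2_closure M (lin_span B)"
  using assms
  by (induction I rule: infinite_finite_induct)
    (auto intro: L2_closure_add L2_closure_subset L2_space_0 lin_span_0)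

lemma L2_closure_limit:
  assumes fL: "f \<in> L2_space M"
    and s: "\<And>i. s i \<in> L2_closure M V"
    and lim: "(\<lambda>i. LINT x|M. (cmod (f x - s i x))\<^sup>2) \<longlonglongrightarrow> 0"
  shows "f \<in> L2_closure M V"
  unfolding L2_closure_def
proof (intro CollectI conjI allI impI)
  show "f \<in> L2_space M" by fact
  fix \<epsilon> :: real assume "\<epsilon> > 0"
  then have \<epsilon>: "\<epsilon> / 4 > 0" by simp
  have "eventually (\<lambda>i. (LINT x|M. (cmod (f x - s i x))\<^sup>2) < \<epsilon> / 4) sequentially"
    using lim \<epsilon> by (rule order_tendstoD)
  then obtain i where i: "(LINT x|M. (cmod (f x - s i x))\<^sup>2) < \<epsilon> / 4"
    by (auto simp: eventually_sequentially)
  obtain g where g: "g \<in> V \<inter> L2_space M" "(LINT x|M. (cmod (s i x - g x))\<^sup>2) < \<epsilon> / 4"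
    using s[of i] \<epsilon> unfolding L2_closure_def by blast
  have "(LINT x|M. (cmod (f x - g x))\<^sup>2) \<le>
      2 * (LINT x|M. (cmod (f x - s i x))\<^sup>2) + 2 * (LINT x|M. (cmod (s i x - g x))\<^sup>2)"
    using g fL s[of i] by (intro L2_dist_triangle) (auto simp: L2_closure_def)
  also have "\<dots> < \<epsilon>" using i g by simp
  finally show "\<exists>h\<in>V \<inter> L2_space M. (LINT x|M. (cmod (f x - h x))\<^sup>2) < \<epsilon>"
    using g by blast
qed

text \<open>Dominated convergence. The factor 2 is the bound that comes with the simple functions
  approximating a measurable function. Convergence is required on \<open>space M\<close> only, so
  even a constant sequence is useful: it replaces a function by one that differs from it off the
  space.\<close>

lemma L2_closure_dominated:
  assumes fL: "f \<in> L2_space M"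
    and s: "\<And>i. s i \<in> L2_closure M V"
    and conv: "\<And>x. x \<in> space M \<Longrightarrow> (\<lambda>i. s i x) \<longlonglongrightarrow> f x"
    and dom: "\<And>i x. x \<in> space M \<Longrightarrow> cmod (s i x) \<le> 2 * cmod (f x)"
  shows "f \<in> L2_closure M V"
proof (rule L2_closure_limit[OF fL s])
  have [measurable]: "f \<in> borel_measurable M" "\<And>i. s i \<in> borel_measurable M"
    and int: "integrable M (\<lambda>x. (cmod (f x))\<^sup>2)"
    using fL s unfolding L2_closure_def L2_space_def by auto
  have "(\<lambda>i. LINT x|M. (cmod (f x - s i x))\<^sup>2) \<longlonglongrightarrow> (LINT x|M. 0)"
  \<comment> \<open>\<open>|f - s i| <= |f| + 2|f|\<close>, and squaring the 3 gives 9.\<close>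
  proof (rule integral_dominated_convergence[where w = "\<lambda>x. 9 * (cmod (f x))\<^sup>2"])
    show "AE x in M. (\<lambda>i. (cmod (f x - s i x))\<^sup>2) \<longlonglongrightarrow> 0"
    proof (rule AE_I2)
      fix x assume "x \<in> space M"
      then have "(\<lambda>i. (cmod (f x - s i x))\<^sup>2) \<longlonglongrightarrow> (cmod (f x - f x))\<^sup>2"
        by (intro tendsto_intros conv)
      then show "(\<lambda>i. (cmod (f x - s i x))\<^sup>2) \<longlonglongrightarrow> 0" by simp
    qed
    show "AE x in M. norm ((cmod (f x - s i x))\<^sup>2) \<le> 9 * (cmod (f x))\<^sup>2" for i
    proof (rule AE_I2)
      fix x assume "x \<in> space M"
      then have "cmod (f x - s i x) \<le> 3 * cmod (f x)"
        using norm_triangle_ineq4[of "f x" "s i x"] dom[of x i] by simp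
      then have "(cmod (f x - s i x))\<^sup>2 \<le> (3 * cmod (f x))\<^sup>2"
        by (intro power_mono) auto
      then show "norm ((cmod (f x - s i x))\<^sup>2) \<le> 9 * (cmod (f x))\<^sup>2"
        by (simp add: power_mult_distrib)
    qed
  qed (use int in auto)
  then show "(\<lambda>i. LINT x|M. (cmod (f x - s i x))\<^sup>2) \<longlonglongrightarrow> 0" by simp
qed

section \<open>Density from an intersection-stable generator\<close>

text \<open>Dynkin's argument: the sets whose indicator lies in the closure are stable under
  complements and countable disjoint unions, so they include the sigma-algebra generated by an
  intersection-stable family of such sets.\<close>

lemma (in finite_measure) indicator_in_L2_closure:
  assumes G: "G \<subseteq> Pow (space M)" "Int_stable G" "sets M = sigma_sets (space M) G"
    and one: "(\<lambda>x. 1) \<in> L2_closure M (lin_span B)"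
    and ind: "\<And>S. S \<in> G \<Longrightarrow> indicator S \<in> L2_closure M (lin_span B)"
    and "S \<in> sets M"
  shows "(indicator S :: 'a \<Rightarrow> complex) \<in> L2_closure M (lin_span B)"
proof -
  have "S \<in> sigma_sets (space M) G" using assms by simp
  from G(2,1) this show ?thesis
  proof (induction rule: sigma_sets_induct_disjoint)
    case (basic S)
    then show ?case by (rule ind)
  next
    case empty
    have "(indicator {} :: 'a \<Rightarrow> complex) = (\<lambda>x. 0)" by auto
    then show ?case using L2_closure_subset[OF lin_span_0 L2_space_0] by metis
  next
    case (compl S)
    have "S \<in> sets M" using compl(1) G(3) by simp
    show ?case
    \<comment> \<open>Outside \<open>space M\<close> the function \<open>1 - indicator S\<close> is
      1 and the indicator of the complement is 0; the constant sequence bridges this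
      difference.\<close>
    proof (rule L2_closure_dominated[where s = "\<lambda>_ x. 1 + (- 1) * indicator S x"])
      show "(indicator (space M - S) :: 'a \<Rightarrow> complex) \<in> L2_space M"
        using \<open>S \<in> sets M\<close> by (intro L2_space_indicator) auto
      show "(\<lambda>x. 1 + (- 1) * indicator S x) \<in> L2_closure M (lin_span B)"
        by (intro L2_closure_add one L2_closure_scale compl.IH)
    qed (auto simp: indicator_def)
  next
    case (union S)
    have S: "S i \<in> sets M" for i using union(2) G(3) by auto
    show ?case
    proof (rule L2_closure_dominated[where s = "\<lambda>n x. \<Sum>i<n. indicator (S i) x"])
      show "(indicator (\<Union>i. S i) :: 'a \<Rightarrow> complex) \<in> L2_space M"
        using S by (intro L2_space_indicator) auto
      show "(\<lambda>x. \<Sum>i<n. indicator (S i) x) \<in> L2_closure M (lin_span B)" for n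
        by (intro L2_closure_sum union.IH)
      have eq: "(\<Sum>i<n. indicator (S i) x) = (indicator (\<Union>i<n. S i) x :: complex)" for n x
        using union(1)
        by (subst indicator_UN_disjoint) (auto simp: disjoint_family_on_def)
      show "(\<lambda>n. \<Sum>i<n. indicator (S i) x) \<longlonglongrightarrow> (indicator (\<Union>i. S i) x :: complex)" for x
        unfolding eq by (rule LIMSEQ_indicator_UN)
      show "cmod (\<Sum>i<n. indicator (S i) x) \<le> 2 * cmod (indicator (\<Union>i. S i) x)" for n x
        unfolding eq by (auto simp: indicator_def)
    qed
  qed
qed

lemma (in finite_measure) L2_closure_eq_L2_space:
  assumes G: "G \<subseteq> Pow (space M)" "Int_stable G" "sets M = sigma_sets (space M) G"
    and one: "(\<lambda>x. 1) \<in> L2_closure M (lin_span B)"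
    and ind: "\<And>S. S \<in> G \<Longrightarrow> indicator S \<in> L2_closure M (lin_span B)"
  shows "L2_closure M (lin_span B) = L2_space M"
proof (intro equalityI subsetI)
  fix f assume f: "f \<in> L2_space M"
  then have "f \<in> borel_measurable M" unfolding L2_space_def by simp
  from borel_measurable_implies_sequence_metric[OF this, of 0]
  obtain s where s: "\<And>i. simple_function M (s i)"
    "\<And>x. x \<in> space M \<Longrightarrow> (\<lambda>i. s i x) \<longlonglongrightarrow> f x"
    "\<And>i x. x \<in> space M \<Longrightarrow> dist (s i x) 0 \<le> 2 * dist (f x) 0"
    by blast
  \<comment> \<open>The canonical form of the simple function \<open>s i\<close>, a finite
    combination of indicators of measurable sets; it equals \<open>s i\<close> on the space.\<close>
  let ?s = "\<lambda>i x. \<Sum>y\<in>s i ` space M. y * indicator (s i -` {y} \<inter> space M) x"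
  have eq: "?s i x = s i x" if "x \<in> space M" for i x
  proof -
    have "?s i x = (\<Sum>y\<in>s i ` space M. if y = s i x then y else 0)"
      using that by (intro sum.cong) (auto simp: indicator_def)
    then show ?thesis using that s(1)[of i] by (simp add: simple_function_def)
  qed
  show "f \<in> L2_closure M (lin_span B)"
  proof (rule L2_closure_dominated[OF f, where s = ?s])
    show "?s i \<in> L2_closure M (lin_span B)" for i
    proof (intro L2_closure_sum L2_closure_scale indicator_in_L2_closure[OF assms])
      fix y assume "y \<in> s i ` space M"
      then show "s i -` {y} \<inter> space M \<in> sets M"
        using s(1)[of i] by (auto simp: simple_function_def)
    qed
    show "(\<lambda>i. ?s i x) \<longlonglongrightarrow> f x" if "x \<in> space M" for x
      unfolding eq[OF that] using s(2) that by blast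
    show "cmod (?s i x) \<le> 2 * cmod (f x)" if "x \<in> space M" for i x
      unfolding eq[OF that] using s(3)[OF that] by simp
  qed
qed (auto simp: L2_closure_def)

lemma orthonormal_basis_if_dense:
  assumes B: "L2_orthonormal M B" and dense: "L2_space M \<subseteq> L2_closure M (lin_span B)"
  shows "L2_orthonormal_basis M B"
  unfolding L2_orthonormal_basis_def
proof (intro conjI B ballI allI impI)
  fix f and \<epsilon> :: real assume "f \<in> L2_space M" "\<epsilon> > 0"
  \<comment> \<open>\<open>L2_closure\<close> measures squared distances and \<open>L2_norm\<close>
    takes the root, hence \<open>\<epsilon>\<close> squared.\<close>
  then have "f \<in> L2_closure M (lin_span B)" "\<epsilon>\<^sup>2 > 0" using dense by auto
  then obtain g where g: "g \<in> lin_span B" "(LINT x|M. (cmod (f x - g x))\<^sup>2) < \<epsilon>\<^sup>2"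
    unfolding L2_closure_def by blast
  obtain T c where T: "finite T" "T \<subseteq> B" "g = (\<lambda>x. \<Sum>b\<in>T. c b * b x)"
    using g(1) unfolding lin_span_def by blast
  have "L2_norm M (\<lambda>x. f x - (\<Sum>b\<in>T. c b * b x)) < sqrt (\<epsilon>\<^sup>2)"
    unfolding L2_norm_def using g(2) T(3) by (intro real_sqrt_less_mono) simp
  then show "\<exists>T c. finite T \<and> T \<subseteq> B \<and> L2_norm M (\<lambda>x. f x - (\<Sum>b\<in>T. c b * b x)) < \<epsilon>"
    using T \<open>\<epsilon> > 0\<close> by auto
qed

section \<open>Inner products and orthogonal matrices\<close>

lemma L2_inner_commute: "L2_inner M g f = cnj (L2_inner M f g)"
  unfolding L2_inner_def using Bochner_Integration.integral_cnj[of M "\<lambda>x. f x * cnj (g x)"] by (simp add: mult.commute)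

lemma integral_indicator_complex:
  assumes "S \<in> sets M"
  shows "(LINT x|M. indicator S x) = complex_of_real (measure M S)"
proof -
  have "(LINT x|M. indicator S x :: complex) = (LINT x|M. complex_of_real (indicator S x))"
    by (intro Bochner_Integration.integral_cong) (auto simp: indicator_def)
  then show ?thesis using assms by simp
qed

lemma powr_minus_half:
  assumes "y > (0 :: real)"
  shows "y powr (-1/2) = inverse (sqrt y)" and "y powr - (1/2) = inverse (sqrt y)"
  using assms powr_minus[of y "1/2"] by (simp_all add: powr_half_sqrt)

text \<open>For a square matrix a left inverse is also a right inverse, so orthonormal columns force
  orthonormal rows.\<close>

lemma orthonormal_rows_if_columns:
  fixes a :: "nat \<Rightarrow> nat \<Rightarrow> real"
  assumes "\<And>i j. i \<in> {1..n} \<Longrightarrow> j \<in> {1..n} \<Longrightarrow> (\<Sum>k = 1..n. a k i * a k j) = of_bool (i = j)"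
    and "i \<in> {1..n}" and "k \<in> {1..n}"
  shows "(\<Sum>j = 1..n. a i j * a k j) = of_bool (i = k)"
proof -
  define M where "M = Matrix.mat n n (\<lambda>(k, j). a (Suc k) (Suc j))"
  have M: "M \<in> carrier_mat n n" "M\<^sup>T \<in> carrier_mat n n" unfolding M_def by auto
  have shift: "(\<Sum>j = 1..n. f j) = (\<Sum>j\<in>{0..<n}. f (Suc j))" for f :: "nat \<Rightarrow> real"
    by (simp add: sum.atLeast1_atMost_eq atLeast0LessThan)
  have "M\<^sup>T * M = 1\<^sub>m n"
  proof (rule eq_matI)
    fix i j assume "i < dim_row (1\<^sub>m n :: real mat)" "j < dim_col (1\<^sub>m n :: real mat)"
    then have ij: "i < n" "j < n" by auto
    then show "(M\<^sup>T * M) $$ (i, j) = 1\<^sub>m n $$ (i, j)"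
      using assms(1)[of "Suc i" "Suc j"]
      by (simp add: M_def shift scalar_prod_def del: One_nat_def)
  qed (use M in auto)
  then have "M * M\<^sup>T = 1\<^sub>m n"
    using mat_mult_left_right_inverse[OF M(2,1)] by simp
  then have "(M * M\<^sup>T) $$ (i - 1, k - 1) = 1\<^sub>m n $$ (i - 1, k - 1)" by simp
  then show ?thesis using assms(2,3)
    by (auto simp: M_def shift scalar_prod_def eq_diff_iff simp del: One_nat_def split: if_splits)
qed

section \<open>Cylinder sets\<close>

text \<open>Irreducibility makes a diagonal entry of some power \<open>n >= 1\<close> positive, so
  row \<open>a\<close> of the matrix cannot vanish; a nonzero entry of a 0-1 matrix is 1.\<close>

lemma successor_exists:
  assumes A: "A \<in> carrier_mat l l" and zo: "zero_one_matrix A" and irr: "irreducible_matrix A"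
    and a: "a \<in> alphabet A"
  shows "\<exists>b\<in>alphabet A. entry A a b = 1"
proof -
  \<comment> \<open>Powers grow by a factor on the right, so the row index \<open>i\<close> stays
    fixed while the column \<open>j\<close> varies in the induction.\<close>
  have pow: "\<exists>j<l. A $$ (i, j) > 0" if "i < l" "j < l" "(A ^\<^sub>m Suc m) $$ (i, j) > 0" for i j m
    using that
  proof (induction m arbitrary: j)
    case 0
    then show ?case using A by auto
  next
    case (Suc m)
    have "(A ^\<^sub>m Suc (Suc m)) $$ (i, j) = (\<Sum>k<l. (A ^\<^sub>m Suc m) $$ (i, k) * A $$ (k, j))"
      using Suc.prems A
      by (subst pow_mat.simps) (auto simp: scalar_prod_def lessThan_atLeast0 simp del: pow_mat.simps)
    with Suc.prems(3) obtain k where "k < l" "(A ^\<^sub>m Suc m) $$ (i, k) > 0"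
      by (metis (no_types, lifting) bot_nat_0.not_eq_extremum lessThan_iff mult_eq_0_iff sum.neutral)
    with Suc.IH Suc.prems(1) show ?case by blast
  qed
  obtain n where n: "n \<ge> 1" "entry (A ^\<^sub>m n) a a > 0"
    using irr a unfolding irreducible_matrix_def by blast
  then obtain m where "n = Suc m" by (cases n) auto
  with n pow[of "a - 1" "a - 1" m] a A obtain j where j: "j < l" "A $$ (a - 1, j) > 0"
    unfolding entry_def alphabet_def by fastforce
  then have b: "Suc j \<in> alphabet A" "entry A a (Suc j) \<noteq> 0"
    using A unfolding entry_def alphabet_def by auto
  moreover from this have "entry A a (Suc j) \<in> {0, 1}"
    using zo a unfolding zero_one_matrix_def by blast
  ultimately show ?thesis by auto
qed

lemma letter_word: "a \<in> alphabet A \<Longrightarrow> [a] \<in> words A"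
  unfolding words_def by auto

lemma cylinder_subset_shift_space: "cylinder A x \<subseteq> shift_space A"
  unfolding cylinder_def by auto

lemma mem_cylinder_iff:
  "\<omega> \<in> cylinder A x \<longleftrightarrow> \<omega> \<in> shift_space A \<and> (\<forall>i<length x. \<omega> i = x ! i)"
proof -
  have "prefix_word \<omega> (length x) = x \<longleftrightarrow> (\<forall>i<length x. \<omega> i = x ! i)"
    unfolding prefix_word_def by (subst list_eq_iff_nth_eq) simp
  then show ?thesis unfolding cylinder_def by blast
qed

lemma mem_cylinder_snoc:
  "\<omega> \<in> cylinder A (x @ [a]) \<longleftrightarrow> \<omega> \<in> cylinder A x \<and> \<omega> (length x) = a"
  by (auto simp: mem_cylinder_iff nth_append less_Suc_eq)

text \<open>Membership in \<open>[z]\<close> depends only on the first \<open>length z\<close>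
  letters, and \<open>[y]\<close> fixes these. Hence \<open>[y]\<close> lies inside
  \<open>[z]\<close> or misses it, the dichotomy behind the base property, intersection stability
  and the constancy of step functions on finer cylinders.\<close>

lemma mem_cylinder_cong:
  assumes "\<omega> \<in> cylinder A y" "\<omega>' \<in> cylinder A y" "length z \<le> length y"
  shows "\<omega> \<in> cylinder A z \<longleftrightarrow> \<omega>' \<in> cylinder A z"
  using assms by (auto simp: mem_cylinder_iff)

lemma cylinder_disjoint:
  assumes "length x = length y" "x \<noteq> y"
  shows "cylinder A x \<inter> cylinder A y = {}"
  using assms unfolding cylinder_def by fastforce

lemma next_letter_in_successors:
  assumes "\<omega> \<in> cylinder A x" "x \<noteq> []"
  shows "\<omega> (length x) \<in> successors A x"
proof -
  have "last x = \<omega> (length x - 1)"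
    using assms by (simp add: mem_cylinder_iff last_conv_nth)
  then show ?thesis
    using assms unfolding successors_def mem_cylinder_iff shift_space_def
    by (auto dest!: spec[of _ "length x - 1"])
qed

lemma snoc_in_words_iff:
  assumes "x \<noteq> []"
  shows "x @ [a] \<in> words A \<longleftrightarrow> x \<in> words A \<and> a \<in> successors A x"
proof -
  have "(\<forall>i. Suc i < length (x @ [a]) \<longrightarrow> entry A ((x @ [a]) ! i) ((x @ [a]) ! Suc i) = 1) \<longleftrightarrow>
      (\<forall>i. Suc i < length x \<longrightarrow> entry A (x ! i) (x ! Suc i) = 1) \<and> entry A (last x) a = 1"
    (is "?L \<longleftrightarrow> ?R")
  proof
    assume L: ?L
    have "entry A (x ! i) (x ! Suc i) = 1" if "Suc i < length x" for i
      using L[rule_format, of i] that by (simp add: nth_append)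
    moreover have "entry A (last x) a = 1"
      using L[rule_format, of "length x - 1"] assms by (simp add: nth_append last_conv_nth)
    ultimately show ?R by blast
  next
    assume R: ?R
    show ?L
    proof (intro allI impI)
      fix i assume "Suc i < length (x @ [a])"
      then consider "Suc i < length x" | "i = length x - 1" "Suc i = length x" by fastforce
      then show "entry A ((x @ [a]) ! i) ((x @ [a]) ! Suc i) = 1"
        using R assms by cases (auto simp: nth_append last_conv_nth)
    qed
  qed
  then show ?thesis
    using assms unfolding words_def successors_def by auto
qed

text \<open>A choice \<open>f\<close> of successors continues the word forever from its last
  letter.\<close>

lemma cylinder_nonempty:
  assumes succ: "\<And>a. a \<in> alphabet A \<Longrightarrow> \<exists>b\<in>alphabet A. entry A a b = 1"
    and x: "x \<in> words A"
  shows "cylinder A x \<noteq> {}"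
proof -
  obtain f where f: "\<And>a. a \<in> alphabet A \<Longrightarrow> f a \<in> alphabet A \<and> entry A a (f a) = 1"
    using succ by metis
  have last: "last x \<in> alphabet A" and "x \<noteq> []" using x unfolding words_def by auto
  have iter: "(f ^^ m) (last x) \<in> alphabet A" for m
    by (induction m) (use f last in auto)
  \<comment> \<open>The exponent is 1 at position \<open>length x\<close>, the first one after the
    word, so \<open>f\<close> is applied once to the last letter there.\<close>
  define \<omega> where "\<omega> i = (if i < length x then x ! i else (f ^^ (Suc i - length x)) (last x))" for i
  have "\<omega> i \<in> alphabet A" for i
    using iter x unfolding \<omega>_def words_def by auto
  moreover have "entry A (\<omega> i) (\<omega> (Suc i)) = 1" for i
  proof -
    consider "Suc i < length x" | "Suc i = length x" | "length x < Suc i" by linarith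
    then show ?thesis
    proof cases
      case 1
      then show ?thesis using x unfolding \<omega>_def words_def by auto
    next
      case 2
      then have "i = length x - 1" by simp
      with 2 have "\<omega> i = last x" "\<omega> (Suc i) = f (last x)"
        using \<open>x \<noteq> []\<close> unfolding \<omega>_def by (auto simp: last_conv_nth Suc_diff_le)
      then show ?thesis using f last by simp
    next
      case 3
      then have "\<omega> (Suc i) = f (\<omega> i)"
        unfolding \<omega>_def by (simp add: Suc_diff_le)
      then show ?thesis using f \<open>\<omega> i \<in> alphabet A\<close> by simp
    qed
  qed
  ultimately have "\<omega> \<in> cylinder A x"
    unfolding mem_cylinder_iff shift_space_def by (simp add: \<omega>_def)
  then show ?thesis by blast
qed

section \<open>Cylinders as a base of the topology and a generator of the Borel sets\<close>

text \<open>Of two cylinders with a common point, the one with the longer word lies in the other. So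
  the cylinders are a base and not merely a subbase.\<close>

lemma openin_shift_topology_cylinder:
  assumes "openin (shift_topology A) V" "\<omega> \<in> V"
  shows "\<exists>x\<in>words A. \<omega> \<in> cylinder A x \<and> cylinder A x \<subseteq> V"
proof -
  have "generate_topology_on (cylinder A ` words A) V"
    using assms(1) unfolding shift_topology_def openin_topology_generated_by_iff .
  then show ?thesis using assms(2)
  proof (induction)
    case (Int V W)
    then obtain x y where xy: "x \<in> words A" "y \<in> words A" "\<omega> \<in> cylinder A x" "\<omega> \<in> cylinder A y"
      "cylinder A x \<subseteq> V" "cylinder A y \<subseteq> W" by blast
    have "cylinder A y \<subseteq> cylinder A x" if "length x \<le> length y"
      using mem_cylinder_cong[OF _ _ that] xy by blast
    moreover have "cylinder A x \<subseteq> cylinder A y" if "length y \<le> length x"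
      using mem_cylinder_cong[OF _ _ that] xy by blast
    ultimately show ?case using xy by (metis le_inf_iff nle_le subset_trans)
  next
    case (UN K)
    then obtain X where "X \<in> K" "\<omega> \<in> X" by blast
    then show ?case using UN.IH by (meson Union_upper subset_trans)
  qed auto
qed

text \<open>There are only countably many words, so every open set is a countable union of
  cylinders. The empty set joins the generator because disjoint cylinders intersect in it.\<close>

lemma sets_shift_borel:
  "sets (shift_borel A) = sigma_sets (shift_space A) (insert {} (cylinder A ` words A))"
  and space_shift_borel: "space (shift_borel A) = shift_space A"
proof -
  have sub: "V \<subseteq> shift_space A" if "openin (shift_topology A) V" for V
    using openin_shift_topology_cylinder[OF that] cylinder_subset_shift_space by blast
  then have Pow: "{V. openin (shift_topology A) V} \<subseteq> Pow (shift_space A)" by auto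
  then show "space (shift_borel A) = shift_space A"
    unfolding shift_borel_def by (simp add: space_measure_of)
  have "sets (shift_borel A) = sigma_sets (shift_space A) {V. openin (shift_topology A) V}"
    unfolding shift_borel_def using Pow by (rule sets_measure_of)
  also have "\<dots> = sigma_sets (shift_space A) (insert {} (cylinder A ` words A))"
  proof (rule sigma_sets_eqI)
    fix V assume "V \<in> {V. openin (shift_topology A) V}"
    then have V: "V = (\<Union>x\<in>{x \<in> words A. cylinder A x \<subseteq> V}. cylinder A x)"
      using openin_shift_topology_cylinder[of A V] by blast
    show "V \<in> sigma_sets (shift_space A) (insert {} (cylinder A ` words A))"
      by (subst V, rule sigma_sets_UNION) (auto intro!: countable_image sigma_sets.Basic)
  next
    fix V assume "V \<in> insert {} (cylinder A ` words A)"
    then show "V \<in> sigma_sets (shift_space A) {V. openin (shift_topology A) V}"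
      unfolding shift_topology_def
      by (auto intro: sigma_sets.Basic sigma_sets.Empty topology_generated_by_Basis)
  qed
  finally show "sets (shift_borel A) = sigma_sets (shift_space A) (insert {} (cylinder A ` words A))" .
qed

lemma Int_stable_cylinders: "Int_stable (insert {} (cylinder A ` words A))"
proof (rule Int_stableI)
  have "cylinder A x \<inter> cylinder A y \<in> {{}, cylinder A y}" if "length x \<le> length y" for x y
    using mem_cylinder_cong[OF _ _ that] by blast
  then have *: "cylinder A x \<inter> cylinder A y \<in> {{}, cylinder A x, cylinder A y}" for x y
    by (metis Int_commute insert_iff nle_le)
  fix V W assume "V \<in> insert {} (cylinder A ` words A)" "W \<in> insert {} (cylinder A ` words A)"
  then consider "V \<inter> W = {}"
    | x y where "x \<in> words A" "y \<in> words A" "V = cylinder A x" "W = cylinder A y"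
    by blast
  then show "V \<inter> W \<in> insert {} (cylinder A ` words A)"
  proof cases
    case (2 x y)
    then show ?thesis using *[of x y] by (metis imageI insert_iff singletonD)
  qed simp
qed

section \<open>Step functions on cylinders\<close>

text \<open>Positivity of all cylinder measures stands in for the Gibbs property; it makes the
  weights and the normalising powers invertible.\<close>

locale cylinder_system = finite_measure \<mu> for \<mu> :: "(nat \<Rightarrow> nat) measure" +
  fixes A :: "nat mat" and \<theta> :: "nat list \<Rightarrow> nat \<Rightarrow> nat" and U :: "nat list \<Rightarrow> real mat"
  assumes sets_eq: "sets \<mu> = sets (shift_borel A)"
    and measure_cylinder_pos: "\<And>x. x \<in> words A \<Longrightarrow> measure \<mu> (cylinder A x) > 0"
    and theta_bij: "\<And>x. x \<in> words A \<Longrightarrow> bij_betw (\<theta> x) (successors A x) {1..num_ext A x}"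
    and U_Omega: "\<And>x. x \<in> words A \<Longrightarrow> U x \<in> Omega A \<mu> \<theta> x"
begin

abbreviation "n \<equiv> num_ext A"
abbreviation "cyl \<equiv> cylinder A"
abbreviation "ext x k \<equiv> cylinder A (ext_word A \<theta> x k)"
abbreviation "w \<equiv> ext_measure A \<mu> \<theta>"
abbreviation "letter x k \<equiv> inv_into (successors A x) (\<theta> x) k"
abbreviation "e \<equiv> efun A \<mu> \<theta> U"

text \<open>This is the value of \<open>e x j\<close> on the \<open>k\<close>-th child of
  \<open>[x]\<close>: the inner product with \<open>f_{x,k}\<close> is \<open>sqrt (w x k)\<close>
  times this coordinate, and the power \<open>-1/2\<close> in \<open>efun\<close> cancels the
  root.\<close>

definition v :: "nat list \<Rightarrow> nat \<Rightarrow> nat \<Rightarrow> real" where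
  "v x j k = vec_index (U x *\<^sub>v fvec A \<mu> \<theta> x j) (k - 1)"

lemma space_eq: "space \<mu> = shift_space A"
  using sets_eq_imp_space_eq[OF sets_eq] space_shift_borel by simp

lemma sets_cylinder [measurable]: "x \<in> words A \<Longrightarrow> cyl x \<in> sets \<mu>"
  unfolding sets_eq sets_shift_borel by (auto intro!: sigma_sets.Basic)

lemma letter_bij: "x \<in> words A \<Longrightarrow> bij_betw (letter x) {1..n x} (successors A x)"
  using bij_betw_inv_into[OF theta_bij] by simp

lemma letter_in_successors: "x \<in> words A \<Longrightarrow> k \<in> {1..n x} \<Longrightarrow> letter x k \<in> successors A x"
  using letter_bij bij_betwE by blast

lemma ext_word_in_words:
  assumes "x \<in> words A" "k \<in> {1..n x}"
  shows "ext_word A \<theta> x k \<in> words A"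
proof -
  have "x \<noteq> []" using assms unfolding words_def by auto
  then show ?thesis
    using assms letter_in_successors unfolding ext_word_def by (simp add: snoc_in_words_iff)
qed

lemma mem_ext_iff: "\<omega> \<in> ext x k \<longleftrightarrow> \<omega> \<in> cyl x \<and> \<omega> (length x) = letter x k"
  unfolding ext_word_def by (rule mem_cylinder_snoc)

lemma ext_exists:
  assumes "x \<in> words A" "\<omega> \<in> cyl x"
  obtains k where "k \<in> {1..n x}" "\<omega> \<in> ext x k"
proof -
  have "x \<noteq> []" using assms unfolding words_def by auto
  then have "\<omega> (length x) \<in> letter x ` {1..n x}"
    using next_letter_in_successors[OF assms(2)] bij_betw_imp_surj_on[OF letter_bij[OF assms(1)]]
    by simp
  then show thesis using assms(2) that by (auto simp: mem_ext_iff)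
qed

lemma ext_unique:
  assumes "x \<in> words A" "k \<in> {1..n x}" "k' \<in> {1..n x}" "\<omega> \<in> ext x k" "\<omega> \<in> ext x k'"
  shows "k = k'"
proof (rule inj_onD[OF bij_betw_imp_inj_on[OF letter_bij[OF assms(1)]]])
  show "letter x k = letter x k'" using assms(4,5) by (simp add: mem_ext_iff)
qed fact+

lemma sum_indicator_ext:
  assumes "x \<in> words A" "k \<in> {1..n x}" "\<omega> \<in> ext x k"
  shows "(\<Sum>i = 1..n x. c i * indicator (ext x i) \<omega>) = (c k :: 'b :: comm_semiring_1)"
proof -
  have "(\<Sum>i = 1..n x. c i * indicator (ext x i) \<omega>) = (\<Sum>i = 1..n x. if i = k then c i else 0)"
    using assms ext_unique by (intro sum.cong) (auto simp: indicator_def)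
  then show ?thesis using assms(2) by simp
qed

lemma ext_measure_pos: "x \<in> words A \<Longrightarrow> k \<in> {1..n x} \<Longrightarrow> w x k > 0"
  unfolding ext_measure_def using measure_cylinder_pos ext_word_in_words by blast

text \<open>A cylinder of positive measure has a point, and the letter of that point after
  \<open>x\<close> is numbered by \<open>\<theta> x\<close>. The membership form makes
  \<open>n x\<close> an admissible index.\<close>

lemma num_ext_pos:
  assumes "x \<in> words A"
  shows "n x \<in> {1..n x}"
proof -
  obtain \<omega> where "\<omega> \<in> cyl x" using measure_cylinder_pos[OF assms] by (cases "cyl x = {}") auto
  then obtain k where "k \<in> {1..n x}" by (rule ext_exists[OF assms])
  then show ?thesis by simp
qed

lemma weighted_inner_fvec:
  assumes "x \<in> words A" "k \<in> {1..n x}"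
  shows "weighted_inner A \<mu> \<theta> x (fvec A \<mu> \<theta> x k) r = sqrt (w x k) * vec_index r (k - 1)"
proof -
  have "weighted_inner A \<mu> \<theta> x (fvec A \<mu> \<theta> x k) r =
      (\<Sum>j = 1..n x. if j = k then w x k * inverse (sqrt (w x k)) * vec_index r (k - 1) else 0)"
    using assms ext_measure_pos[OF assms] unfolding weighted_inner_def fvec_def
    by (intro sum.cong) (auto simp: powr_minus_half eq_diff_iff)
  then show ?thesis using assms ext_measure_pos[OF assms]
    by (simp add: real_div_sqrt flip: divide_inverse)
qed

lemma fvec_orthonormal:
  assumes "x \<in> words A" "i \<in> {1..n x}" "j \<in> {1..n x}"
  shows "weighted_inner A \<mu> \<theta> x (fvec A \<mu> \<theta> x i) (fvec A \<mu> \<theta> x j) = of_bool (i = j)"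
  using assms ext_measure_pos[OF assms(1,3)]
  by (subst weighted_inner_fvec) (auto simp: fvec_def powr_minus_half eq_diff_iff)

text \<open>\<open>U x\<close> preserves the weighted inner product, so it carries the orthonormal
  vectors \<open>f_{x,j}\<close> to orthonormal ones.\<close>

lemma v_orthonormal:
  assumes "x \<in> words A" "i \<in> {1..n x}" "j \<in> {1..n x}"
  shows "(\<Sum>k = 1..n x. w x k * v x i k * v x j k) = of_bool (i = j)"
proof -
  have f: "fvec A \<mu> \<theta> x m \<in> carrier_vec (n x)" for m
    unfolding fvec_def by simp
  have "weighted_inner A \<mu> \<theta> x (U x *\<^sub>v fvec A \<mu> \<theta> x i) (U x *\<^sub>v fvec A \<mu> \<theta> x j) =
      weighted_inner A \<mu> \<theta> x (fvec A \<mu> \<theta> x i) (fvec A \<mu> \<theta> x j)"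
    using U_Omega[OF assms(1)] f unfolding Omega_def by blast
  then show ?thesis
    using fvec_orthonormal[OF assms] unfolding weighted_inner_def v_def by simp
qed

text \<open>Scaling by \<open>sqrt (w x k)\<close> turns the values into an orthogonal matrix, whose
  rows are orthonormal too. This is the completeness relation that expands indicators of
  children.\<close>

lemma v_orthonormal_dual:
  assumes "x \<in> words A" "k \<in> {1..n x}" "k' \<in> {1..n x}"
  shows "(\<Sum>j = 1..n x. w x k * v x j k * v x j k') = of_bool (k = k')"
proof -
  let ?a = "\<lambda>k j. sqrt (w x k) * v x j k"
  have "(\<Sum>j = 1..n x. ?a k j * ?a k' j) = of_bool (k = k')"
  proof (rule orthonormal_rows_if_columns)
    fix i j assume ij: "i \<in> {1..n x}" "j \<in> {1..n x}"
    have "(\<Sum>k = 1..n x. ?a k i * ?a k j) = (\<Sum>k = 1..n x. w x k * v x i k * v x j k)"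
      using ext_measure_pos[OF assms(1)] by (intro sum.cong) (auto simp: less_eq_real_def)
    then show "(\<Sum>k = 1..n x. ?a k i * ?a k j) = of_bool (i = j)"
      using v_orthonormal[OF assms(1) ij] by simp
  qed fact+
  moreover have "(\<Sum>j = 1..n x. ?a k j * ?a k' j) =
      sqrt (w x k) * sqrt (w x k') * (\<Sum>j = 1..n x. v x j k * v x j k')"
    by (simp add: sum_distrib_left mult_ac)
  moreover have "(\<Sum>j = 1..n x. w x k * v x j k * v x j k') = w x k * (\<Sum>j = 1..n x. v x j k * v x j k')"
    by (simp add: sum_distrib_left mult_ac)
  \<comment> \<open>The weights \<open>w x k\<close> and \<open>sqrt (w x k) * sqrt (w x k')\<close>
    agree for \<open>k = k'\<close>; otherwise both are positive and the remaining sum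
    vanishes.\<close>
  ultimately show ?thesis
    using ext_measure_pos[OF assms(1,2)] ext_measure_pos[OF assms(1,3)]
    by (cases "k = k'") auto
qed

lemma efun_eq:
  assumes "x \<in> words A"
  shows "e x j \<omega> = (\<Sum>k = 1..n x. of_real (v x j k) * indicator (ext x k) \<omega>)"
  unfolding efun_def
proof (intro sum.cong refl arg_cong2[of _ _ _ _ "(*)"] arg_cong[of _ _ of_real])
  fix k assume "k \<in> {1..n x}"
  then show "w x k powr (-1/2) * weighted_inner A \<mu> \<theta> x (fvec A \<mu> \<theta> x k) (U x *\<^sub>v fvec A \<mu> \<theta> x j) = v x j k"
    using assms ext_measure_pos[of x k] by (subst weighted_inner_fvec) (auto simp: v_def powr_minus_half)
qed

lemma efun_on_ext:
  assumes "x \<in> words A" "k \<in> {1..n x}" "\<omega> \<in> ext x k"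
  shows "e x j \<omega> = of_real (v x j k)"
  unfolding efun_eq[OF assms(1)] by (rule sum_indicator_ext[OF assms])

lemma efun_outside: "x \<in> words A \<Longrightarrow> \<omega> \<notin> cyl x \<Longrightarrow> e x j \<omega> = 0"
  by (simp add: efun_eq mem_ext_iff)

text \<open>
  The index \<open>j = \<alpha>(x)\<close>, excluded from the basis, yields the normalised indicator of \<open>[x]\<close>. So at
  words of length 1 it yields the remaining basis functions, and together with \<open>j < \<alpha>(x)\<close> it yields
  an orthonormal basis of the step functions on the children of \<open>[x]\<close>.
\<close>

lemma efun_last:
  assumes "x \<in> words A"
  shows "e x (n x) \<omega> = of_real (measure \<mu> (cyl x) powr (-1/2)) * indicator (cyl x) \<omega>"
proof (cases "\<omega> \<in> cyl x")
  case True
  then obtain k where k: "k \<in> {1..n x}" "\<omega> \<in> ext x k" by (rule ext_exists[OF assms])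
  have "v x (n x) k = measure \<mu> (cyl x) powr (-1/2)"
    using U_Omega[OF assms] k unfolding Omega_def v_def by auto
  then show ?thesis using True efun_on_ext[OF assms k] by simp
qed (simp add: efun_outside assms)

lemma cnj_efun: "cnj (e x j \<omega>) = e x j \<omega>"
  unfolding efun_def by (auto simp: indicator_def intro!: sum.cong)

lemma efun_L2:
  assumes "x \<in> words A"
  shows "e x j \<in> L2_space \<mu>"
proof -
  have "e x j = (\<lambda>\<omega>. \<Sum>k = 1..n x. of_real (v x j k) * indicator (ext x k) \<omega>)"
    using efun_eq[OF assms] by blast
  then show ?thesis
    by (simp only:) (intro L2_space_sum L2_space_scale L2_space_indicator sets_cylinder
        ext_word_in_words[OF assms])
qed

text \<open>The children of \<open>[x]\<close> are disjoint, so the product is again a step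
  function, and integrating it gives the weighted sum of \<open>v_orthonormal\<close>.\<close>

lemma efun_inner_same:
  assumes "x \<in> words A" "i \<in> {1..n x}" "j \<in> {1..n x}"
  shows "L2_inner \<mu> (e x i) (e x j) = of_bool (i = j)"
proof -
  have "e x i \<omega> * cnj (e x j \<omega>) = (\<Sum>k = 1..n x. of_real (v x i k * v x j k) * indicator (ext x k) \<omega>)" for \<omega>
  proof (cases "\<omega> \<in> cyl x")
    case True
    then obtain k where k: "k \<in> {1..n x}" "\<omega> \<in> ext x k" by (rule ext_exists[OF assms(1)])
    then show ?thesis
      by (subst sum_indicator_ext[OF assms(1) k]) (simp_all add: efun_on_ext[OF assms(1) k])
  qed (simp add: efun_outside assms mem_ext_iff)
  then have "L2_inner \<mu> (e x i) (e x j) =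
      (LINT \<omega>|\<mu>. (\<Sum>k = 1..n x. of_real (v x i k * v x j k) * indicator (ext x k) \<omega>))"
    unfolding L2_inner_def by simp
  also have "\<dots> = (\<Sum>k = 1..n x. of_real (v x i k * v x j k) * of_real (w x k))"
  proof (subst Bochner_Integration.integral_sum)
    fix k assume "k \<in> {1..n x}"
    then have [measurable]: "ext x k \<in> sets \<mu>" using assms ext_word_in_words by auto
    show "integrable \<mu> (\<lambda>\<omega>. complex_of_real (v x i k * v x j k) * indicator (ext x k) \<omega>)"
      by (intro integrable_mult_right integrable_const_bound[of _ 1]) (auto simp: indicator_def)
  next
    show "(\<Sum>k = 1..n x. LINT \<omega>|\<mu>. complex_of_real (v x i k * v x j k) * indicator (ext x k) \<omega>) =
      (\<Sum>k = 1..n x. of_real (v x i k * v x j k) * of_real (w x k))"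
    proof (intro sum.cong refl)
      fix k assume "k \<in> {1..n x}"
      then have [measurable]: "ext x k \<in> sets \<mu>" using assms ext_word_in_words by auto
      show "(LINT \<omega>|\<mu>. complex_of_real (v x i k * v x j k) * indicator (ext x k) \<omega>) =
          of_real (v x i k * v x j k) * of_real (w x k)"
        using integral_indicator_complex[of "ext x k" \<mu>] by (simp add: ext_measure_def)
    qed
  qed
  also have "\<dots> = of_real (\<Sum>k = 1..n x. w x k * v x i k * v x j k)"
    by (simp add: mult_ac)
  finally show ?thesis unfolding v_orthonormal[OF assms] by simp
qed

text \<open>A function constant on \<open>[x]\<close> acts there as a multiple of \<open>e\<^sub>x\<^sub>,\<^sub>\<alpha>\<^sub>(\<^sub>x\<^sub>)\<close>.\<close>

lemma efun_orthogonal_const: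
  assumes x: "x \<in> words A" and j: "j \<in> {1..n x - 1}"
    and g: "\<And>\<omega>. \<omega> \<in> cyl x \<Longrightarrow> g \<omega> = c"
  shows "L2_inner \<mu> (e x j) g = 0"
proof -
  define m where "m = complex_of_real (measure \<mu> (cyl x) powr (-1/2))"
  have "m \<noteq> 0" using measure_cylinder_pos[OF x] unfolding m_def by simp
  have "cnj m = m" unfolding m_def by simp
  have "e x (n x) \<omega> = m" if "\<omega> \<in> cyl x" for \<omega>
    unfolding m_def using that by (simp add: efun_last[OF x])
  \<comment> \<open>Off \<open>[x]\<close> the factor \<open>e x j\<close> vanishes, so the values
    of \<open>g\<close> there do not matter.\<close>
  then have "e x j \<omega> * cnj (g \<omega>) = (cnj c / m) * (e x j \<omega> * cnj (e x (n x) \<omega>))" for \<omega>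
    using g \<open>m \<noteq> 0\<close> \<open>cnj m = m\<close> efun_outside[OF x]
    by (cases "\<omega> \<in> cyl x") (auto simp: cnj_efun)
  then have "L2_inner \<mu> (e x j) g = (cnj c / m) * L2_inner \<mu> (e x j) (e x (n x))"
    unfolding L2_inner_def by simp
  then show ?thesis using efun_inner_same[OF x _ num_ext_pos[OF x], of j] j by auto
qed

text \<open>The words of the children of \<open>[x]\<close> have length \<open>length x + 1\<close>,
  at most that of \<open>y\<close>, so \<open>[y]\<close> lies in or outside each child.\<close>

lemma efun_const_on_cylinder:
  assumes "x \<in> words A" "length x < length y" "\<omega> \<in> cyl y" "\<omega>' \<in> cyl y"
  shows "e x j \<omega> = e x j \<omega>'"
proof -
  have "\<omega> \<in> ext x k \<longleftrightarrow> \<omega>' \<in> ext x k" for k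
    using assms by (intro mem_cylinder_cong) (auto simp: ext_word_def)
  then show ?thesis unfolding efun_eq[OF assms(1)] by (simp add: indicator_def)
qed

section \<open>Orthonormality of the whole system\<close>

text \<open>Writing the normalised indicators of letters as \<open>e [a] (n [a])\<close> puts both
  kinds of basis functions into one family.\<close>

definition indices :: "(nat list \<times> nat) set" where
  "indices = {(x, j). x \<in> words A \<and> j \<in> {1..n x - 1}} \<union> {([a], n [a]) | a. a \<in> alphabet A}"

lemma indicesD:
  assumes "(x, j) \<in> indices"
  shows "x \<in> words A" "j \<in> {1..n x}" "length x = 1 \<or> j \<in> {1..n x - 1}"
  using assms letter_word num_ext_pos unfolding indices_def by auto

lemma efun_inner_longer:
  assumes "(x, i) \<in> indices" "(y, j) \<in> indices" "length x < length y"
  shows "L2_inner \<mu> (e y j) (e x i) = 0"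
proof -
  have "x \<noteq> []" using indicesD(1)[OF assms(1)] unfolding words_def by auto
  \<comment> \<open>\<open>y\<close> has at least two letters, so the exceptional last index cannot
    occur at \<open>y\<close>.\<close>
  then have j: "j \<in> {1..n y - 1}" using indicesD(3)[OF assms(2)] assms(3) by auto
  have y: "y \<in> words A" using indicesD(1)[OF assms(2)] .
  then obtain \<omega>' where "\<omega>' \<in> cyl y" using measure_cylinder_pos[OF y] by (cases "cyl y = {}") auto
  then have "e x i \<omega> = e x i \<omega>'" if "\<omega> \<in> cyl y" for \<omega>
    using efun_const_on_cylinder indicesD(1)[OF assms(1)] assms(3) that by blast
  then show ?thesis by (rule efun_orthogonal_const[OF y j])
qed

lemma efun_inner:
  assumes "(x, i) \<in> indices" "(y, j) \<in> indices"
  shows "L2_inner \<mu> (e x i) (e y j) = of_bool ((x, i) = (y, j))"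
proof -
  note x = indicesD[OF assms(1)] and y = indicesD[OF assms(2)]
  consider "x = y" | "x \<noteq> y" "length x = length y" | "length x < length y" | "length y < length x"
    by linarith
  then show ?thesis
  proof cases
    case 1
    then show ?thesis using efun_inner_same x y by simp
  next
    case 2
    then have 0: "e x i \<omega> * cnj (e y j \<omega>) = 0" for \<omega>
      using efun_outside x(1) y(1) cylinder_disjoint[of x y A] by (cases "\<omega> \<in> cyl x") auto
    then show ?thesis using 2 unfolding L2_inner_def 0 by simp
  next
    case 3
    then show ?thesis using efun_inner_longer[OF assms] L2_inner_commute[of \<mu> "e x i"] by auto
  next
    case 4
    then show ?thesis using efun_inner_longer[OF assms(2,1)] by auto
  qed
qed

abbreviation "basis \<equiv> (\<lambda>(x, j). e x j) ` indices"

lemma basis_orthonormal: "L2_orthonormal \<mu> basis"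
  unfolding L2_orthonormal_def
proof (intro conjI ballI)
  show "basis \<subseteq> L2_space \<mu>" using efun_L2 indicesD(1) by auto
  fix f g assume "f \<in> basis" "g \<in> basis"
  then obtain x i y j where "(x, i) \<in> indices" "(y, j) \<in> indices" "f = e x i" "g = e y j" by auto
  \<comment> \<open>Different indices give different functions: otherwise one function would have
    inner product 0 and 1 with itself. So equality of indices may be replaced by equality of
    functions.\<close>
  then show "L2_inner \<mu> f g = (if f = g then 1 else 0)"
    using efun_inner[of x i y j] efun_inner[of x i x i] by (auto split: if_splits)
qed

section \<open>Density of the span\<close>

lemma indicator_cylinder_in_span:
  "x \<in> words A \<Longrightarrow> (indicator (cyl x) :: _ \<Rightarrow> complex) \<in> lin_span basis"
proof (induction x rule: rev_induct)
  case Nil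
  then show ?case unfolding words_def by simp
next
  case (snoc a x)
  have last: "indicator (cyl y) = (\<lambda>\<omega>. inverse (of_real (measure \<mu> (cyl y) powr (-1/2))) * e y (n y) \<omega>)"
    if "y \<in> words A" for y
    using measure_cylinder_pos[OF that] by (intro ext) (simp add: efun_last[OF that])
  show ?case
  proof (cases "x = []")
    case True
    then have "([a], n [a]) \<in> indices" using snoc.prems unfolding indices_def words_def by auto
    then have "e [a] (n [a]) \<in> lin_span basis" by (intro lin_span_base) force
    then show ?thesis using last[OF snoc.prems] True by (auto intro: lin_span_scale)
  next
    case False
    then have x: "x \<in> words A" and a: "a \<in> successors A x"
      using snoc.prems snoc_in_words_iff by auto
    then obtain k where k: "k \<in> {1..n x}" "letter x k = a"
      using bij_betw_imp_surj_on[OF letter_bij[OF x]] by (metis imageE)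
    then have xa: "cyl (x @ [a]) = ext x k" by (simp add: ext_word_def)
    \<comment> \<open>The coefficient \<open>w x k * v x j k\<close> is the inner product of the
      child's indicator with \<open>e x j\<close>.\<close>
    have "indicator (ext x k) \<omega> = (\<Sum>j = 1..n x. of_real (w x k * v x j k) * e x j \<omega>)" for \<omega>
    proof (cases "\<omega> \<in> cyl x")
      case True
      then obtain k' where k': "k' \<in> {1..n x}" "\<omega> \<in> ext x k'" by (rule ext_exists[OF x])
      have "(\<Sum>j = 1..n x. of_real (w x k * v x j k) * e x j \<omega>) =
          complex_of_real (\<Sum>j = 1..n x. w x k * v x j k * v x j k')"
        by (simp add: efun_on_ext[OF x k'])
      also have "\<dots> = indicator (ext x k) \<omega>"
        using v_orthonormal_dual[OF x k(1) k'(1)] ext_unique[OF x k(1) k'(1) _ k'(2)] k'(2)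
        by (auto simp: indicator_def)
      finally show ?thesis by simp
    qed (simp add: efun_outside x mem_ext_iff)
    then have eq: "indicator (ext x k) = (\<lambda>\<omega>. \<Sum>j = 1..n x. of_real (w x k * v x j k) * e x j \<omega>)"
      by blast
    have "e x j \<in> lin_span basis" if "j \<in> {1..n x}" for j
    proof (cases "j = n x")
      \<comment> \<open>The last index gives a multiple of the indicator of the parent
        \<open>[x]\<close>, which the induction hypothesis covers.\<close>
      case True
      have "e x (n x) = (\<lambda>\<omega>. of_real (measure \<mu> (cyl x) powr (-1/2)) * indicator (cyl x) \<omega>)"
        using efun_last[OF x] by blast
      then show ?thesis using True snoc.IH[OF x] by (auto intro: lin_span_scale)
    next
      case False
      then have "(x, j) \<in> indices" using that x unfolding indices_def by auto
      then show ?thesis by (intro lin_span_base) force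
    qed
    then show ?thesis unfolding xa eq by (intro lin_span_sum lin_span_scale)
  qed
qed

lemma L2_closure_basis: "L2_closure \<mu> (lin_span basis) = L2_space \<mu>"
proof (rule L2_closure_eq_L2_space)
  show "insert {} (cylinder A ` words A) \<subseteq> Pow (space \<mu>)"
    using cylinder_subset_shift_space space_eq by auto
  show "Int_stable (insert {} (cylinder A ` words A))" by (rule Int_stable_cylinders)
  show "sets \<mu> = sigma_sets (space \<mu>) (insert {} (cylinder A ` words A))"
    using sets_eq sets_shift_borel space_eq by simp
  have cyl: "(indicator (cyl x) :: _ \<Rightarrow> complex) \<in> L2_closure \<mu> (lin_span basis)" if "x \<in> words A" for x
    using that by (intro L2_closure_subset indicator_cylinder_in_span L2_space_indicator sets_cylinder)
  show "(indicator S :: _ \<Rightarrow> complex) \<in> L2_closure \<mu> (lin_span basis)"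
    if "S \<in> insert {} (cylinder A ` words A)" for S
  proof (cases "S = {}")
    case True
    then have "(indicator S :: _ \<Rightarrow> complex) = (\<lambda>x. 0)" by auto
    then show ?thesis using L2_closure_subset[OF lin_span_0 L2_space_0] by metis
  qed (use that cyl in auto)
  show "(\<lambda>x. 1) \<in> L2_closure \<mu> (lin_span basis)"
  \<comment> \<open>The cylinders of single letters partition the shift space, but their indicators
    sum to 1 only there; hence again a constant sequence.\<close>
  proof (rule L2_closure_dominated[where s = "\<lambda>_ \<omega>. \<Sum>a\<in>alphabet A. indicator (cyl [a]) \<omega>"])
    show "(\<lambda>x. 1) \<in> L2_space \<mu>" by (rule L2_space_bounded[of _ 1]) auto
    show "(\<lambda>\<omega>. \<Sum>a\<in>alphabet A. indicator (cyl [a]) \<omega>) \<in> L2_closure \<mu> (lin_span basis)"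
      by (intro L2_closure_sum cyl letter_word)
    have one: "(\<Sum>a\<in>alphabet A. indicator (cyl [a]) \<omega>) = (1 :: complex)" if "\<omega> \<in> space \<mu>" for \<omega>
    proof -
      have \<omega>: "\<omega> \<in> shift_space A" using that space_eq by simp
      then have "(\<Sum>a\<in>alphabet A. indicator (cyl [a]) \<omega>) =
          (\<Sum>a\<in>alphabet A. if a = \<omega> 0 then 1 else (0 :: complex))"
        by (intro sum.cong) (auto simp: mem_cylinder_iff indicator_def)
      then show ?thesis using \<omega> unfolding shift_space_def alphabet_def by simp
    qed
    show "(\<lambda>_. \<Sum>a\<in>alphabet A. indicator (cyl [a]) \<omega>) \<longlonglongrightarrow> (1 :: complex)" if "\<omega> \<in> space \<mu>" for \<omega>
      by (simp add: one[OF that])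
    show "cmod (\<Sum>a\<in>alphabet A. indicator (cyl [a]) \<omega>) \<le> 2 * cmod 1" if "\<omega> \<in> space \<mu>" for \<omega>
      by (simp add: one[OF that])
  qed
qed

lemma basis_eq:
  "basis = {e x j | x j. x \<in> words A \<and> j \<in> {1..n x - 1}} \<union>
     {(\<lambda>\<omega>. complex_of_real (measure \<mu> (cyl [a]) powr (-1/2)) * indicator (cyl [a]) \<omega>) | a. a \<in> alphabet A}"
proof -
  have "e [a] (n [a]) = (\<lambda>\<omega>. complex_of_real (measure \<mu> (cyl [a]) powr (-1/2)) * indicator (cyl [a]) \<omega>)"
    if "a \<in> alphabet A" for a
    using efun_last[OF letter_word[OF that]] by blast
  then have "(\<lambda>(x, j). e x j) ` {([a], n [a]) | a. a \<in> alphabet A} =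
     {(\<lambda>\<omega>. complex_of_real (measure \<mu> (cyl [a]) powr (-1/2)) * indicator (cyl [a]) \<omega>) | a. a \<in> alphabet A}"
    by (force simp: image_def)
  then show ?thesis unfolding indices_def image_Un by (auto simp: image_def)
qed

lemma basis_orthonormal_basis: "L2_orthonormal_basis \<mu> basis"
  using basis_orthonormal L2_closure_basis by (intro orthonormal_basis_if_dense) auto

end

section \<open>From Gibbs measures to the basis theorem\<close>

text \<open>The lower Gibbs bound at any point of the cylinder keeps its measure above a positive
  multiple of an exponential.\<close>

lemma gibbs_cylinder_pos:
  assumes gibbs: "gibbs_measure A \<phi> \<mu>" and x: "x \<in> words A" and "cylinder A x \<noteq> {}"
  shows "measure \<mu> (cylinder A x) > 0"
proof -
  obtain \<omega> where \<omega>: "\<omega> \<in> shift_space A" "prefix_word \<omega> (length x) = x"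
    using assms(3) unfolding cylinder_def by blast
  obtain c where c: "c > 1" and bound: "\<And>k \<omega>. k \<ge> 1 \<Longrightarrow> \<omega> \<in> shift_space A \<Longrightarrow>
      inverse c \<le> measure \<mu> (cylinder A (prefix_word \<omega> k)) /
        exp (birkhoff_sum \<phi> k \<omega> - real k * pressure A \<phi>)"
    using gibbs unfolding gibbs_measure_def Let_def by blast
  have "length x \<ge> 1" using x unfolding words_def by (cases x) auto
  then have "inverse c \<le> measure \<mu> (cylinder A x) /
      exp (birkhoff_sum \<phi> (length x) \<omega> - real (length x) * pressure A \<phi>)"
    using bound[OF _ \<omega>(1), of "length x"] \<omega>(2) by simp
  moreover have "inverse c > 0" using c by simp
  ultimately have "0 < measure \<mu> (cylinder A x) /
      exp (birkhoff_sum \<phi> (length x) \<omega> - real (length x) * pressure A \<phi>)" by linarith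
  then show ?thesis by (simp add: zero_less_divide_iff)
qed

theorem theorem3p5:
  fixes l :: nat
    and A :: "nat mat"
    and \<phi> :: "(nat \<Rightarrow> nat) \<Rightarrow> real"
    and \<mu> :: "(nat \<Rightarrow> nat) measure"
    and \<theta> :: "nat list \<Rightarrow> nat \<Rightarrow> nat"
    and U :: "nat list \<Rightarrow> real mat"
  assumes "l \<ge> 1"
    and "A \<in> carrier_mat l l"
    and "zero_one_matrix A"
    and "irreducible_matrix A"
    and "aperiodic_matrix A"
    and "continuous_map (shift_topology A) euclideanreal \<phi>"
    and "holder_continuous A \<phi>"
    and "gibbs_measure A \<phi> \<mu>"
    and "\<And>x. x \<in> words A \<Longrightarrow> bij_betw (\<theta> x) (successors A x) {1..num_ext A x}"
    and "\<And>x. x \<in> words A \<Longrightarrow> U x \<in> Omega A \<mu> \<theta> x"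
  shows "L2_orthonormal_basis \<mu>
           ({efun A \<mu> \<theta> U x j | x j. x \<in> words A \<and> j \<in> {1..num_ext A x - 1}} \<union>
            {(\<lambda>\<omega>. complex_of_real (measure \<mu> (cylinder A [a]) powr (-1/2)) *
                   indicator (cylinder A [a]) \<omega>) | a. a \<in> alphabet A})"
proof -
  interpret prob_space \<mu> using assms(8) unfolding gibbs_measure_def by blast
  interpret cylinder_system \<mu> A \<theta> U
  proof unfold_locales
    show "sets \<mu> = sets (shift_borel A)" using assms(8) unfolding gibbs_measure_def by blast
    show "measure \<mu> (cylinder A x) > 0" if "x \<in> words A" for x
      using gibbs_cylinder_pos[OF assms(8) that]
        cylinder_nonempty[OF successor_exists[OF assms(2,3,4)] that] by blast
  qed fact+
  show ?thesis using basis_orthonormal_basis unfolding basis_eq .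
qed

end
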